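(* Let $n \ge 2$ and $k \ge 1$ be integers, let $(n_i)_{i \ge 0}$ denote the $n$-nacci sequence, and let $S = \{n_n, n_{n+1}, \ldots, n_{n+k-1}\}$ be the set of numbers of cookies in $k$ jars. Then $\mathrm{CM}(S) = \left\lceil \frac{n-1}{n}(k-1) \right\rceil + 1$.
   Context: For an integer $n \ge 2$, the $n$-nacci sequence $(n_i)_{i\ge 0}$ (here $n_i$ denotes the $i$-th term of the sequence) is defined by $n_0 = n_1 = \cdots = n_{n-2} = 0$, $n_{n-1} = 1$, and each later term is the sum of the previous $n$ terms: $n_i = n_{i-1} + n_{i-2} + \cdots + n_{i-n}$ for $i \ge n$. For example, the case $n=4$ begins $0, 0, 0, 1, 1, 2, 4, 8, 15, 29, 56, 108, \ldots$. A set $S = \{j_1 < j_2 < \cdots < j_k\}$ of distinct positive integers represents $k$ jars, where the $i$-th jar initially contains $j_i$ cookies. A move consists of choosing any subset of the jars and a positive integer $a$, such that every chosen jar currently contains at least $a$ cookies, and removing exactly $a$ cookies from each chosen jar (the same number from each). The Cookie Monster number $\mathrm{CM}(S)$ is the minimum number of moves needed to empty all of the jars. *)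

theory Defs
  imports Complex_Main
begin

text \<open>Only the case \<open>n \<ge> 2\<close> is of interest; the equation is total so that no
  assumption on \<open>n\<close> is needed in the definition.\<close>

function nacci :: "nat \<Rightarrow> nat \<Rightarrow> nat" where
  "nacci n i =
     (if i + 1 < n then 0
      else if i + 1 = n then 1
      else (\<Sum>j = 1..n. nacci n (i - j)))"
  by pat_completeness auto
termination
  by (relation "measure snd") auto

declare nacci.simps [simp del]

text \<open>A configuration \<open>c\<close> assigns to each jar its current number of cookies.\<close>

definition cookie_move :: "'j set \<Rightarrow> ('j \<Rightarrow> nat) \<Rightarrow> ('j \<Rightarrow> nat) \<Rightarrow> bool" where
  "cookie_move J c c' \<longleftrightarrow>
     (\<exists>A a. A \<subseteq> J \<and> 0 < a \<and> (\<forall>j\<in>A. a \<le> c j) \<and>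
            c' = (\<lambda>j. if j \<in> A then c j - a else c j))"

text \<open>As the jars have distinct initial contents, each jar is named by its initial
  content: the set of jars is \<open>S\<close> itself and the initial configuration is the identity.
  For finite \<open>S\<close> the minimum exists, since the jars can be emptied one at a time.\<close>

definition CM :: "nat set \<Rightarrow> nat" where
  "CM S = (LEAST m. \<exists>c. (cookie_move S ^^ m) (\<lambda>j. j) c \<and> (\<forall>j\<in>S. c j = 0))"

end

theory Submission
  imports Defs
begin

text \<open>
  The order of the moves is irrelevant: emptying the jars with \<open>m\<close> moves amounts to choosing
  \<open>m\<close> positive amounts such that every jar size is a sum over some of the chosen amounts.
  So \<open>CM S\<close> is the least number of positive integers whose subset sums cover \<open>S\<close>
  (\<open>CM_eqI\<close>).

  Write \<open>s i = nacci n (n + i)\<close> for the jar sizes, \<open>i < k\<close>, and drop the positive multiples of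
  \<open>n\<close> from the index range. Telescoping the recurrence over blocks of length \<open>n\<close> shows that each
  dropped \<open>s (q * n)\<close> is exactly the sum of all retained \<open>s j\<close> with \<open>j < q * n\<close>. This single identity
  (\<open>sum_core\<close>) settles both bounds. The retained terms themselves are a valid choice of
  amounts, because each dropped term is a sum of them. Conversely, each retained term exceeds the
  sum of the smaller retained terms, because that sum collapses to fewer than \<open>n\<close> consecutive
  predecessors; and a set in which every element exceeds the sum of the smaller ones cannot be
  covered by the subset sums of fewer amounts than it has elements
  (\<open>superincreasing_card_le\<close>). Hence \<open>CM\<close> is the number of retained
  indices, \<open>k - (k - 1) div n\<close>.
\<close>

section \<open>Moves and subset sums\<close>

lemma moves_imp_subset_sums:
  assumes "(cookie_move J ^^ m) c c'"
  shows "\<exists>a I. \<forall>j. I j \<subseteq> {..<m} \<and> c j = c' j + (\<Sum>i\<in>I j. a i)"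
  using assms
proof (induction m arbitrary: c')
  case 0
  then show ?case by (intro exI[of _ "\<lambda>_. 0"] exI[of _ "\<lambda>_. {}"]) auto
next
  case (Suc m)
  then obtain d where d: "(cookie_move J ^^ m) c d" "cookie_move J d c'"
    by auto
  from Suc.IH[OF d(1)] obtain a I
    where I: "\<And>j. I j \<subseteq> {..<m}" and c: "\<And>j. c j = d j + (\<Sum>i\<in>I j. a i)"
    by blast
  from d(2) obtain A b where b: "\<forall>j\<in>A. b \<le> d j"
    and c': "c' = (\<lambda>j. if j \<in> A then d j - b else d j)"
    unfolding cookie_move_def by blast
  let ?a = "a(m := b)" and ?I = "\<lambda>j. if j \<in> A then insert m (I j) else I j"
  have "?I j \<subseteq> {..<Suc m} \<and> c j = c' j + (\<Sum>i\<in>?I j. ?a i)" for j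
  proof -
    have fin: "finite (I j)" and m: "m \<notin> I j"
      using I[of j] finite_subset by auto
    have "(\<Sum>i\<in>I j. ?a i) = (\<Sum>i\<in>I j. a i)"
      using m by (intro sum.cong) auto
    then show ?thesis
      using I[of j] c[of j] b fin m by (auto simp: c')
  qed
  then show ?case
    by (intro exI[of _ ?a] exI[of _ ?I] allI)
qed

text \<open>
  The amounts can be removed in any order: at each stage a jar holds exactly the sum of its pending
  amounts, hence at least the one that is removed next.
\<close>

lemma subset_sums_imp_moves:
  assumes "finite P" and "\<And>p. p \<in> P \<Longrightarrow> 0 < a p"
    and "\<And>j. j \<in> J \<Longrightarrow> I j \<subseteq> P" and "\<And>j. j \<in> J \<Longrightarrow> c j = (\<Sum>i\<in>I j. a i)"
  shows "\<exists>c'. (cookie_move J ^^ card P) c c' \<and> (\<forall>j\<in>J. c' j = 0)"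
  using assms
proof (induction P arbitrary: c I rule: finite_induct)
  case empty
  then show ?case by auto
next
  case (insert p P)
  let ?A = "{j \<in> J. p \<in> I j}"
  let ?d = "\<lambda>j. if j \<in> ?A then c j - a p else c j"
  have fin: "finite (I j)" if "j \<in> J" for j
    using insert.prems(2)[OF that] insert.hyps(1) by (meson finite.insertI finite_subset)
  have split: "c j = a p + (\<Sum>i\<in>I j - {p}. a i)" if "j \<in> ?A" for j
    using that fin insert.prems(3) by (simp add: sum.remove)
  have step: "cookie_move J c ?d"
    unfolding cookie_move_def
    by (intro exI[of _ ?A] exI[of _ "a p"]) (use split insert.prems(1) in auto)
  have "\<exists>c'. (cookie_move J ^^ card P) ?d c' \<and> (\<forall>j\<in>J. c' j = 0)"
  proof (rule insert.IH)
    show "I j - {p} \<subseteq> P" if "j \<in> J" for j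
      using insert.prems(2)[OF that] by auto
    show "?d j = (\<Sum>i\<in>I j - {p}. a i)" if "j \<in> J" for j
      using that split[of j] insert.prems(3)[OF that] by auto
  qed (use insert.prems(1) in auto)
  then obtain c' where "(cookie_move J ^^ card P) ?d c'" "\<forall>j\<in>J. c' j = 0"
    by blast
  then show ?case
    using relpowp_Suc_I2[of "cookie_move J" c ?d "card P" c', OF step] insert.hyps by auto
qed

lemma CM_eqI:
  assumes "finite P" and "\<And>p. p \<in> P \<Longrightarrow> 0 < a p"
    and repr: "\<And>x. x \<in> S \<Longrightarrow> \<exists>I\<subseteq>P. x = (\<Sum>i\<in>I. a i)"
    and least: "\<And>m (b :: nat \<Rightarrow> nat). (\<And>x. x \<in> S \<Longrightarrow> \<exists>I\<subseteq>{..<m}. x = (\<Sum>i\<in>I. b i)) \<Longrightarrow> card P \<le> m"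
  shows "CM S = card P"
  unfolding CM_def
proof (rule Least_equality)
  obtain I where "\<And>x. x \<in> S \<Longrightarrow> I x \<subseteq> P \<and> x = (\<Sum>i\<in>I x. a i)"
    using repr by metis
  then show "\<exists>c. (cookie_move S ^^ card P) (\<lambda>j. j) c \<and> (\<forall>j\<in>S. c j = 0)"
    using assms(1,2) by (intro subset_sums_imp_moves[where a = a and I = I]) auto
next
  fix m assume "\<exists>c. (cookie_move S ^^ m) (\<lambda>j. j) c \<and> (\<forall>j\<in>S. c j = 0)"
  then obtain c where c: "(cookie_move S ^^ m) (\<lambda>j. j) c" "\<forall>j\<in>S. c j = 0"
    by blast
  from moves_imp_subset_sums[OF c(1)] obtain b I
    where "\<forall>j. I j \<subseteq> {..<m} \<and> j = c j + (\<Sum>i\<in>I j. b i)"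
    by blast
  with c(2) show "card P \<le> m"
    by (intro least[of m b]) (metis add_0)
qed

lemma sum_UN_le:
  fixes a :: "'p \<Rightarrow> nat"
  assumes "finite K" and "\<And>x. x \<in> K \<Longrightarrow> finite (I x)"
  shows "(\<Sum>i\<in>(\<Union>x\<in>K. I x). a i) \<le> (\<Sum>x\<in>K. \<Sum>i\<in>I x. a i)"
  using assms
proof (induction K rule: finite_induct)
  case (insert z K)
  have "(\<Sum>i\<in>(\<Union>x\<in>insert z K. I x). a i) \<le> (\<Sum>i\<in>I z. a i) + (\<Sum>i\<in>(\<Union>x\<in>K. I x). a i)"
    using insert by (simp add: sum_Un_nat)
  then show ?case
    using insert by fastforce
qed simp

text \<open>
  Consider the largest element. The amounts used by the other elements add up to at most the sum of
  these elements, which is too little to make up the largest one. So some amount is used by the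
  largest element alone, and deleting both leaves a smaller instance.
\<close>

lemma superincreasing_card_le:
  fixes t :: "'i::linorder \<Rightarrow> nat" and a :: "'p \<Rightarrow> nat"
  assumes "finite K" and "finite P"
    and "\<And>x. x \<in> K \<Longrightarrow> (\<Sum>y | y \<in> K \<and> y < x. t y) < t x"
    and "\<And>x. x \<in> K \<Longrightarrow> \<exists>I\<subseteq>P. t x = (\<Sum>i\<in>I. a i)"
  shows "card K \<le> card P"
  using assms
proof (induction K arbitrary: P rule: finite_linorder_max_induct)
  case empty
  then show ?case by simp
next
  case (insert z K)
  obtain I where I: "\<And>x. x \<in> insert z K \<Longrightarrow> I x \<subseteq> P \<and> t x = (\<Sum>i\<in>I x. a i)"
    using insert.prems(3) by metis
  have fin: "finite (I x)" if "x \<in> insert z K" for x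
    using I[OF that] insert.prems(1) finite_subset by blast
  have "\<not> I z \<subseteq> (\<Union>x\<in>K. I x)"
  proof
    assume sub: "I z \<subseteq> (\<Union>x\<in>K. I x)"
    have "t z = (\<Sum>i\<in>I z. a i)"
      using I by blast
    also have "\<dots> \<le> (\<Sum>i\<in>(\<Union>x\<in>K. I x). a i)"
      using sub insert.hyps(1) fin by (intro sum_mono2) auto
    also have "\<dots> \<le> (\<Sum>x\<in>K. \<Sum>i\<in>I x. a i)"
      using insert.hyps(1) fin by (intro sum_UN_le) auto
    also have "\<dots> = (\<Sum>y | y \<in> insert z K \<and> y < z. t y)"
      using I insert.hyps(2) by (intro sum.cong) auto
    also have "\<dots> < t z"
      by (rule insert.prems(2)) simp
    finally show False by simp
  qed
  then obtain p where p: "p \<in> I z" "\<And>x. x \<in> K \<Longrightarrow> p \<notin> I x"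
    by blast
  have pP: "p \<in> P"
    using p(1) I by blast
  have "card K \<le> card (P - {p})"
  proof (rule insert.IH)
    show "(\<Sum>y | y \<in> K \<and> y < x. t y) < t x" if "x \<in> K" for x
    proof -
      have "{y. y \<in> K \<and> y < x} = {y. y \<in> insert z K \<and> y < x}"
        using that insert.hyps(2) by force
      then show ?thesis
        using insert.prems(2)[of x] that by simp
    qed
    show "\<exists>I\<subseteq>P - {p}. t x = (\<Sum>i\<in>I. a i)" if "x \<in> K" for x
      using I[of x] p(2)[OF that] that by (intro exI[of _ "I x"]) auto
  qed (use insert.prems(1) in simp)
  moreover have "z \<notin> K"
    using insert.hyps(2) by blast
  moreover have "card P = Suc (card (P - {p}))"
    using insert.prems(1) pP by (rule card.remove)
  ultimately show ?case
    using insert.hyps(1) by simp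
qed

section \<open>The recurrence\<close>

lemma nacci_rec: "nacci n (i + n) = (\<Sum>j\<in>{i..<i + n}. nacci n j)" if "n \<ge> 1"
proof -
  have "nacci n (i + n) = (\<Sum>j = 1..n. nacci n (i + n - j))"
    by (subst nacci.simps) simp
  also have "\<dots> = (\<Sum>j\<in>{i..<i + n}. nacci n j)"
    by (rule sum.reindex_bij_witness[of _ "\<lambda>j. i + n - j" "\<lambda>j. i + n - j"]) auto
  finally show ?thesis .
qed

lemma nacci_pos: "0 < nacci n l" if "n \<ge> 1" "n \<le> l + 1"
  using that(2)
proof (induction l rule: less_induct)
  case (less l)
  show ?case
  proof (cases "l + 1 = n")
    case True
    then show ?thesis by (subst nacci.simps) simp
  next
    case False
    then have l: "nacci n l = (\<Sum>j\<in>{l - n..<l}. nacci n j)" "l - 1 \<in> {l - n..<l}"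
      using nacci_rec[OF that(1), of "l - n"] less.prems that(1) by auto
    moreover have "0 < nacci n (l - 1)"
      using less.prems False that(1) by (intro less.IH) auto
    ultimately show ?thesis
      by (metis finite_atLeastLessThan member_le_sum less_le_trans zero_le)
  qed
qed

section \<open>The retained indices\<close>

text \<open>
  Index \<open>0\<close> is retained although it is a multiple of \<open>n\<close>: no smaller term exists from which the
  first jar could be composed.
\<close>

definition core :: "nat \<Rightarrow> nat \<Rightarrow> nat set" where
  "core n k = {i. i < k \<and> (i = 0 \<or> \<not> n dvd i)}"

lemma finite_core [simp]: "finite (core n k)"
  by (simp add: core_def)

lemma core_Suc: "core n (Suc i) = (if i = 0 \<or> \<not> n dvd i then insert i (core n i) else core n i)"
  by (auto simp: core_def less_Suc_eq)

lemma notin_core [simp]: "i \<notin> core n i"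
  by (simp add: core_def)

lemma card_core: "card (core n (Suc m)) + m div n = Suc m"
proof (induction m)
  case 0
  then show ?case by (simp add: core_Suc) (simp add: core_def)
next
  case (Suc m)
  then show ?case
    by (subst core_Suc) (auto simp: div_Suc dvd_eq_mod_eq_0)
qed

text \<open>
  Appending a retained term lengthens the run of consecutive terms on the right-hand side. At a
  multiple of \<open>n\<close> nothing is appended and the run starts afresh; the sum is unchanged because
  the old run has length \<open>n\<close> by then, so that it adds up to the single term of the new run.
\<close>

lemma sum_core:
  assumes "n \<ge> 1"
  shows "(\<Sum>j\<in>core n (Suc i). nacci n (n + j)) = (\<Sum>l\<in>{n + n * (i div n)..n + i}. nacci n l)"
proof (induction i)
  case 0
  then show ?case by (simp add: core_Suc) (simp add: core_def)
next
  case (Suc i)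
  show ?case
  proof (cases "n dvd Suc i")
    case True
    then have div: "Suc i = n * (i div n) + n"
      by (metis div_Suc dvd_eq_mod_eq_0 dvd_mult_div_cancel mult_Suc_right add.commute)
    then have run: "{n + n * (i div n)..n + i} = {Suc i..<Suc i + n}"
      using assms by auto
    have "(\<Sum>j\<in>core n (Suc (Suc i)). nacci n (n + j)) = (\<Sum>j\<in>core n (Suc i). nacci n (n + j))"
      using True by (subst core_Suc) simp
    also have "\<dots> = nacci n (Suc i + n)"
      using Suc.IH nacci_rec[OF assms, of "Suc i"] by (simp only: run)
    also have "\<dots> = (\<Sum>l\<in>{n + n * (Suc i div n)..n + Suc i}. nacci n l)"
      using True by (simp add: add.commute)
    finally show ?thesis .
  next
    case False
    then have div: "Suc i div n = i div n"
      by (simp add: div_Suc dvd_eq_mod_eq_0)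
    have "n + n * (i div n) \<le> Suc (n + i)"
      using times_div_less_eq_dividend[of n i] by linarith
    then show ?thesis
      using False Suc.IH by (subst core_Suc) (simp add: div add.commute)
  qed
qed

lemma dropped_eq_sum_core:
  assumes "n \<ge> 1" and "0 < i" and "n dvd i"
  shows "nacci n (n + i) = (\<Sum>j\<in>core n i. nacci n (n + j))"
proof -
  have "core n (Suc i) = core n i"
    using assms by (subst core_Suc) simp
  then show ?thesis
    using sum_core[of n i] assms by simp
qed

text \<open>
  The retained sum is a run of fewer than \<open>n\<close> predecessors, while \<open>nacci n (n + i)\<close> is the sum of
  all \<open>n\<close> of them.
\<close>

lemma sum_core_less:
  assumes "n \<ge> 1" and "i = 0 \<or> \<not> n dvd i"
  shows "(\<Sum>j\<in>core n i. nacci n (n + j)) < nacci n (n + i)"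
proof -
  let ?b = "n + n * (i div n)"
  have "(\<Sum>j\<in>core n i. nacci n (n + j)) + nacci n (n + i) = (\<Sum>l\<in>{?b..n + i}. nacci n l)"
    using sum_core[OF assms(1), of i] assms(2) by (subst (asm) core_Suc) simp
  moreover have "?b \<le> n + i"
    by simp
  ultimately have "(\<Sum>j\<in>core n i. nacci n (n + j)) = (\<Sum>l\<in>{?b..<n + i}. nacci n l)"
    by (simp add: sum.last_plus)
  \<comment> \<open>Strictness comes from the term preceding the run: it is still among the \<open>n\<close> predecessors of
    \<open>nacci n (n + i)\<close>, and it is positive even for \<open>i < n\<close>, where it is the seed term \<open>nacci n (n - 1)\<close>.\<close>
  also have "\<dots> < (\<Sum>l\<in>{?b - 1..<n + i}. nacci n l)"
  proof -
    have "?b - 1 < n + i"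
      using assms(1) \<open>?b \<le> n + i\<close> by linarith
    then have "{?b - 1..<n + i} = insert (?b - 1) {?b..<n + i}"
      by auto
    moreover have "0 < nacci n (?b - 1)"
      using assms(1) by (intro nacci_pos) auto
    ultimately show ?thesis
      using assms(1) by simp
  qed
  also have "\<dots> \<le> (\<Sum>l\<in>{i..<i + n}. nacci n l)"
  proof (rule sum_mono2)
    have "i < n + n * (i div n)"
      using assms(1) dividend_less_times_div[of n i] by simp
    then show "{?b - 1..<n + i} \<subseteq> {i..<i + n}"
      by auto
  qed auto
  also have "\<dots> = nacci n (n + i)"
    using nacci_rec[OF assms(1), of i] by (simp add: add.commute)
  finally show ?thesis .
qed

section \<open>The Cookie Monster number\<close>

lemma CM_nacci:
  assumes "n \<ge> 1"
  shows "CM ((\<lambda>i. nacci n (n + i)) ` {..<k}) = card (core n k)"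
proof (rule CM_eqI[where a = "\<lambda>i. nacci n (n + i)"])
  show "0 < nacci n (n + p)" for p
    using assms by (intro nacci_pos) auto
  fix x assume "x \<in> (\<lambda>i. nacci n (n + i)) ` {..<k}"
  then obtain i where i: "i < k" "x = nacci n (n + i)"
    by blast
  show "\<exists>I\<subseteq>core n k. x = (\<Sum>i\<in>I. nacci n (n + i))"
  proof (cases "i \<in> core n k")
    case True
    then show ?thesis
      using i by (intro exI[of _ "{i}"]) auto
  next
    case False
    then have "x = (\<Sum>j\<in>core n i. nacci n (n + j))"
      using i dropped_eq_sum_core[OF assms, of i] by (auto simp: core_def)
    moreover have "core n i \<subseteq> core n k"
      using i by (auto simp: core_def)
    ultimately show ?thesis by blast
  qed
next
  fix m and b :: "nat \<Rightarrow> nat"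
  assume repr: "\<And>x. x \<in> (\<lambda>i. nacci n (n + i)) ` {..<k} \<Longrightarrow> \<exists>I\<subseteq>{..<m}. x = (\<Sum>i\<in>I. b i)"
  have "card (core n k) \<le> card {..<m}"
  proof (rule superincreasing_card_le[where t = "\<lambda>i. nacci n (n + i)" and a = b])
    fix i assume i: "i \<in> core n k"
    then have "{j. j \<in> core n k \<and> j < i} = core n i"
      by (auto simp: core_def)
    then show "(\<Sum>j | j \<in> core n k \<and> j < i. nacci n (n + j)) < nacci n (n + i)"
      using sum_core_less[OF assms, of i] i by (simp add: core_def)
    show "\<exists>I\<subseteq>{..<m}. nacci n (n + i) = (\<Sum>i\<in>I. b i)"
      using i by (intro repr) (auto simp: core_def)
  qed simp_all
  then show "card (core n k) \<le> m" by simp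
qed simp

lemma ceiling_fraction:
  assumes "n \<ge> 1"
  shows "\<lceil>(real n - 1) / real n * real m\<rceil> = int m - int (m div n)"
proof -
  have "(real n - 1) / real n * real m = - (real m / real n) + of_int (int m)"
    using assms by (simp add: field_simps)
  then have "\<lceil>(real n - 1) / real n * real m\<rceil> = \<lceil>- (real m / real n)\<rceil> + int m"
    by (simp only: ceiling_add_of_int)
  then show ?thesis
    by (simp add: ceiling_minus floor_divide_of_nat_eq)
qed

theorem mainTheorem5:
  fixes n k :: nat
  assumes "n \<ge> 2" and "k \<ge> 1"
  shows "int (CM (nacci n ` {n..n + k - 1})) =
           \<lceil>(real n - 1) / real n * (real k - 1)\<rceil> + 1"
proof -
  obtain m where k: "k = Suc m"
    using assms(2) by (cases k) auto
  have "{n..n + k - 1} = (\<lambda>i. n + i) ` {..<k}"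
    by (simp add: k lessThan_atLeast0 atLeastLessThanSuc_atLeastAtMost add.commute)
  then have "nacci n ` {n..n + k - 1} = (\<lambda>i. nacci n (n + i)) ` {..<k}"
    by (simp add: image_image)
  then have "CM (nacci n ` {n..n + k - 1}) = card (core n (Suc m))"
    using CM_nacci[of n k] assms(1) by (simp add: k)
  moreover have "int (card (core n (Suc m))) = int m - int (m div n) + 1"
    using card_core[of n m] by linarith
  ultimately show ?thesis
    using ceiling_fraction[of n m] assms(1) by (simp add: k)
qed

end
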